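(* The class of right-zero bands is $\simeq$-complete for the ceers; that is, for every ceer $R$ there is a c.e. semigroup $S$ which is a right-zero band (given by some positive presentation) such that $R \simeq {=_S}$.
   Context: A ceer is a computably enumerable equivalence relation on $\omega$. A semigroup $S$ is a right-zero band if $ab=b$ for all $a,b\in S$. An algebra $\mathcal{A}$ of decidable type $\tau$ is computably enumerable (c.e.) if it has a positive presentation, i.e. a triple $\langle \omega, F, E\rangle$ where: (1) $F$ consists of computable operations on $\omega$ interpreting $\tau$; (2) $E$ is a ceer which is a congruence for the operations in $F$; (3) the quotient algebra $\langle \omega/E, F_E\rangle$ (the operations being induced on $E$-classes) is isomorphic to $\mathcal{A}$; this quotient is called a c.e. (or positive) copy of $\mathcal A$. The word problem of $\mathcal{A}$, as given by such a positive presentation, is the ceer $E$, denoted $=_\mathcal{A}$. For ceers $R,S$: a reduction from $R$ to $S$ is a computable function $f:\omega\to\omega$ with $x \mathrel{R} y \Leftrightarrow f(x)\mathrel{S} f(y)$ for all $x,y$. $R\simeq S$ (isomorphic) means that there is a reduction from $R$ to $S$ whose range intersects every $S$-equivalence class. A class of algebras of the same type is $\simeq$-complete for the ceers if for every ceer $R$ there is a c.e. copy of an algebra $\mathcal{A}$ in the class with $R\simeq {=_\mathcal{A}}$. *)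

theory Defs
  imports "HOL-Algebra.Congruence"
begin

section \<open>Computable functions and computably enumerable relations\<close>

text \<open>
  Computability on the natural numbers is given by Kleene's partial recursive functions.
  Codes carry no arity: on argument lists of a fixed length, a code denotes a partial
  recursive function of that many arguments.
\<close>

datatype recf =
    Zero
  | Succ
  | Proj nat
  | Comp recf "recf list"
  | PrimRec recf recf
  | Mu recf

text \<open>
  The relation \<open>eval c xs y\<close> says that the computation of \<open>c\<close> on the argument list \<open>xs\<close> halts
  with value \<open>y\<close>. In the last rule, the search reaches \<open>n\<close> only if all the earlier values
  are defined.
\<close>

inductive eval :: "recf \<Rightarrow> nat list \<Rightarrow> nat \<Rightarrow> bool" where
  eval_Zero: "eval Zero xs 0"
| eval_Succ: "eval Succ [x] (Suc x)"
| eval_Proj: "i < length xs \<Longrightarrow> eval (Proj i) xs (xs ! i)"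
| eval_Comp: "list_all2 (\<lambda>g y. eval g xs y) gs ys \<Longrightarrow> eval f ys z \<Longrightarrow> eval (Comp f gs) xs z"
| eval_PrimRec_0: "eval f xs y \<Longrightarrow> eval (PrimRec f g) (0 # xs) y"
| eval_PrimRec_Suc:
    "eval (PrimRec f g) (n # xs) r \<Longrightarrow> eval g (n # r # xs) y \<Longrightarrow>
     eval (PrimRec f g) (Suc n # xs) y"
| eval_Mu:
    "eval f (n # xs) 0 \<Longrightarrow> (\<forall>m<n. \<exists>v. eval f (m # xs) (Suc v)) \<Longrightarrow> eval (Mu f) xs n"
monos list_all2_mono

definition computable1 :: "(nat \<Rightarrow> nat) \<Rightarrow> bool" where
  "computable1 f \<longleftrightarrow> (\<exists>c. \<forall>x y. eval c [x] y \<longleftrightarrow> y = f x)"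

definition computable2 :: "(nat \<Rightarrow> nat \<Rightarrow> nat) \<Rightarrow> bool" where
  "computable2 f \<longleftrightarrow> (\<exists>c. \<forall>x y z. eval c [x, y] z \<longleftrightarrow> z = f x y)"

text \<open>A relation is computably enumerable if it is the domain of a partial recursive function.\<close>

definition ce_rel :: "nat rel \<Rightarrow> bool" where
  "ce_rel R \<longleftrightarrow> (\<exists>c. \<forall>x y. (x, y) \<in> R \<longleftrightarrow> (\<exists>z. eval c [x, y] z))"


section \<open>Ceers\<close>

definition ceer :: "nat rel \<Rightarrow> bool" where
  "ceer R \<longleftrightarrow> equiv UNIV R \<and> ce_rel R"

definition reduction :: "nat rel \<Rightarrow> nat rel \<Rightarrow> (nat \<Rightarrow> nat) \<Rightarrow> bool" where
  "reduction R S f \<longleftrightarrow> computable1 f \<and> (\<forall>x y. (x, y) \<in> R \<longleftrightarrow> (f x, f y) \<in> S)"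

definition ceer_iso :: "nat rel \<Rightarrow> nat rel \<Rightarrow> bool" (infix \<open>\<simeq>\<close> 50) where
  "R \<simeq> S \<longleftrightarrow> (\<exists>f. reduction R S f \<and> (\<forall>C \<in> UNIV // S. range f \<inter> C \<noteq> {}))"


section \<open>Algebras with one binary operation and their positive presentations\<close>

record 'a magma = "'a partial_object" +
  mult :: "'a \<Rightarrow> 'a \<Rightarrow> 'a" (infixl \<open>\<otimes>\<index>\<close> 70)

definition magma_iso :: "'a magma \<Rightarrow> 'b magma \<Rightarrow> ('a \<Rightarrow> 'b) \<Rightarrow> bool" where
  "magma_iso A B h \<longleftrightarrow> bij_betw h (carrier A) (carrier B) \<and>
     (\<forall>a \<in> carrier A. \<forall>b \<in> carrier A. h (a \<otimes>\<^bsub>A\<^esub> b) = h a \<otimes>\<^bsub>B\<^esub> h b)"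

definition quotient_magma :: "(nat \<Rightarrow> nat \<Rightarrow> nat) \<Rightarrow> nat rel \<Rightarrow> nat set magma" where
  "quotient_magma F E =
     \<lparr>carrier = UNIV // E, mult = (\<lambda>X Y. \<Union>x \<in> X. \<Union>y \<in> Y. E `` {F x y})\<rparr>"

definition positive_presentation ::
    "'a magma \<Rightarrow> (nat \<Rightarrow> nat \<Rightarrow> nat) \<Rightarrow> nat rel \<Rightarrow> bool" where
  "positive_presentation A F E \<longleftrightarrow>
     computable2 F \<and> ceer E \<and>
     (\<forall>(x, x') \<in> E. \<forall>(y, y') \<in> E. (F x y, F x' y') \<in> E) \<and>
     (\<exists>h. magma_iso (quotient_magma F E) A h)"

text \<open>
  In a positive presentation of \<open>A\<close> by \<open>F\<close> and \<open>E\<close>, the word problem of \<open>A\<close> is the ceer \<open>E\<close>.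
\<close>

text \<open>
  An algebra with a positive presentation is isomorphic to a quotient of the natural numbers, so
  for isomorphism-closed classes nothing is lost by taking the element type to be \<^typ>\<open>nat set\<close>.
\<close>

definition ceer_complete :: "'a magma set \<Rightarrow> bool" where
  "ceer_complete K \<longleftrightarrow>
     (\<forall>R. ceer R \<longrightarrow> (\<exists>A \<in> K. \<exists>F E. positive_presentation A F E \<and> R \<simeq> E))"

definition semigroup_magma :: "'a magma \<Rightarrow> bool" where
  "semigroup_magma S \<longleftrightarrow>
     (\<forall>a \<in> carrier S. \<forall>b \<in> carrier S. a \<otimes>\<^bsub>S\<^esub> b \<in> carrier S) \<and>
     (\<forall>a \<in> carrier S. \<forall>b \<in> carrier S. \<forall>c \<in> carrier S.
        (a \<otimes>\<^bsub>S\<^esub> b) \<otimes>\<^bsub>S\<^esub> c = a \<otimes>\<^bsub>S\<^esub> (b \<otimes>\<^bsub>S\<^esub> c))"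

definition right_zero_bands :: "'a magma set" where
  "right_zero_bands =
     {S. semigroup_magma S \<and> (\<forall>a \<in> carrier S. \<forall>b \<in> carrier S. a \<otimes>\<^bsub>S\<^esub> b = b)}"

end

theory Submission
  imports Defs
begin

text \<open>
  Every equivalence relation is a congruence for the second projection, and the quotient is a
  right-zero band; so a ceer \<open>R\<close> is itself the word problem of the right-zero band it presents.
\<close>

text \<open>An equivalence, because \<open>computable1\<close> and \<open>computable2\<close> ask
  for halting and for uniqueness of the value.\<close>

lemma eval_Proj_iff: "eval (Proj i) xs y \<longleftrightarrow> i < length xs \<and> y = xs ! i"
  by (auto intro: eval_Proj elim: eval.cases)

lemma computable1_id: "computable1 (\<lambda>x. x)"
  unfolding computable1_def by (rule exI[of _ "Proj 0"]) (simp add: eval_Proj_iff)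

lemma computable2_snd: "computable2 (\<lambda>x y. y)"
  unfolding computable2_def by (rule exI[of _ "Proj 1"]) (simp add: eval_Proj_iff)

text \<open>The identity reduces \<open>R\<close> to itself, and its full range meets every class
  since classes are nonempty.\<close>

lemma ceer_iso_refl: "R \<simeq> R" if "equiv UNIV R"
  unfolding ceer_iso_def reduction_def using computable1_id in_quotient_imp_non_empty[OF that]
  by (intro exI[of _ "\<lambda>x. x"]) auto

lemma positive_presentation_quotient_magma:
  assumes "computable2 F" and "ceer E"
    and "\<And>x x' y y'. (x, x') \<in> E \<Longrightarrow> (y, y') \<in> E \<Longrightarrow> (F x y, F x' y') \<in> E"
  shows "positive_presentation (quotient_magma F E) F E"
proof -
  have "magma_iso (quotient_magma F E) (quotient_magma F E) id"
    unfolding magma_iso_def by simp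
  with assms show ?thesis
    unfolding positive_presentation_def by blast
qed

lemma quotient_magma_snd_right_zero_band:
  assumes E: "equiv UNIV E"
  shows "quotient_magma (\<lambda>x y. y) E \<in> right_zero_bands"
proof -
  \<comment> \<open>This is the right-zero law in the quotient; closure and associativity follow
    from it.\<close>
  have "(\<Union>x\<in>X. \<Union>y\<in>Y. E `` {y}) = Y" if X: "X \<in> UNIV // E" and Y: "Y \<in> UNIV // E" for X Y
  proof -
    have "E `` {y} = Y" if "y \<in> Y" for y
      using Y that by (metis E Image_singleton_iff equiv_class_eq quotientE)
    \<comment> \<open>Over an empty \<open>X\<close> the union would collapse to the empty
      set.\<close>
    moreover have "X \<noteq> {}" "Y \<noteq> {}"
      using in_quotient_imp_non_empty[OF E] X Y by auto
    ultimately show ?thesis by simp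
  qed
  then show ?thesis
    by (simp add: right_zero_bands_def semigroup_magma_def quotient_magma_def)
qed

theorem theorem2p4:
  "ceer_complete (right_zero_bands :: nat set magma set)"
  unfolding ceer_complete_def
proof (intro allI impI)
  fix R assume R: "ceer R"
  then have "equiv UNIV R" by (simp add: ceer_def)
  \<comment> \<open>For the second projection the congruence condition is just the assumption on the
    second pair.\<close>
  moreover from R have "positive_presentation (quotient_magma (\<lambda>x y. y) R) (\<lambda>x y. y) R"
    by (rule positive_presentation_quotient_magma[OF computable2_snd])
  ultimately show "\<exists>A \<in> right_zero_bands. \<exists>F E. positive_presentation (A :: nat set magma) F E \<and> R \<simeq> E"
    using quotient_magma_snd_right_zero_band ceer_iso_refl by blast
qed

end
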